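(* For every integer $n\ge 1$, the invariants $\pi,\rho,\epsilon,w$ of the $n$-fold joins $K^{\ast n}$ of the complexes $K\in\{\widehat{\mathcal P}_3,[3],\mathbb{R}P^2_6,\mathbb{C}P^2_9,\mathbb{H}P^2_{15},\mathfrak{R}_3\}$ are as follows. (1) $\pi(K^{\ast n})=n+1$ for each of these six complexes $K$. (2) $\rho(\widehat{\mathcal P}_3^{\ast n})=\frac{3}{7n}$, $\rho([3]^{\ast n})=\frac{2}{3n}$, $\rho((\mathbb{R}P^2_6)^{\ast n})=\frac{1}{2n}$, $\rho((\mathbb{C}P^2_9)^{\ast n})=\frac{4}{9n}$, $\rho((\mathbb{H}P^2_{15})^{\ast n})=\frac{6}{15n}$, and $\rho(\mathfrak{R}_3^{\ast n})\le\frac{6}{15n}$. (3) $\epsilon(\widehat{\mathcal P}_3^{\ast n})=\lfloor 4n/3\rfloor$, $\epsilon([3]^{\ast n})=\lfloor n/2\rfloor$, $\epsilon((\mathbb{R}P^2_6)^{\ast n})=n$, $\epsilon((\mathbb{C}P^2_9)^{\ast n})=\lfloor 5n/4\rfloor$, $\epsilon((\mathbb{H}P^2_{15})^{\ast n})=\lfloor 3n/2\rfloor$. (4) $w(\widehat{\mathcal P}_3^{\ast n})=7n$, $w([3]^{\ast n})=3n$, $w((\mathbb{R}P^2_6)^{\ast n})=6n$, $w((\mathbb{C}P^2_9)^{\ast n})=9n$, $w((\mathbb{H}P^2_{15})^{\ast n})=15n$, $w(\mathfrak{R}_3^{\ast n})=15n$. (5) $\epsilon((\mathbb{R}P^2_6)^{\ast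 n})/w((\mathbb{R}P^2_6)^{\ast n})=\frac16$ for every $n$, and, as $n\to\infty$, the quotient $\epsilon(K^{\ast n})/w(K^{\ast n})$ tends to $\frac{4}{21}$ for $K=\widehat{\mathcal P}_3$, to $\frac16$ for $K=[3]$, to $\frac{5}{36}$ for $K=\mathbb{C}P^2_9$, and to $\frac{1}{10}$ for $K=\mathbb{H}P^2_{15}$.
   Context: A simplicial complex $K\subseteq 2^{S}$ on a finite set $S$ is a family of subsets of $S$ that contains $\emptyset$ and is closed under taking subsets. Invariants. The partition number $\pi(K)$ is the minimum integer $k$ such that for each partition $A_1\uplus\dots\uplus A_k=S$ (blocks may be empty) at least one of the sets $A_i$ is in $K$. Let $\Delta_S$ be the simplex of probability measures on $S$ (nonnegative weights $x_i$, $i\in S$, with $\sum x_i=1$, and $\mu(A)=\sum_{i\in A}x_i$); put $T_{\mu\le\alpha}=\{A\subseteq S\mid \mu(A)\le\alpha\}$ and $T_{\mu<\alpha}=\{A\subseteq S\mid \mu(A)<\alpha\}$. The threshold characteristic is $$\rho(K)=\sup\{\alpha\in[0,+\infty]\mid \exists\mu\in\Delta_S,\ T_{\mu\le\alpha}\subseteq K\}=\max\{\alpha\in[0,+\infty]\mid \exists\mu\in\Delta_S,\ T_{\mu<\alpha}\subseteq K\}.$$ The non-linearity gap is $\epsilon(K)=\lfloor 1/\rho(K)\rfloor+1-\pi(K)$, and $w(K)=|S|$. Joins. $K_1\ast K_2=\{A\uplus B\mid A\in K_1,B\in K_2\}\subseteq 2^{S_1\uplus S_2}$ for $K_i\subseteq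 2^{S_i}$, and $K^{\ast n}$ is the join of $n$ copies of $K$ (on the disjoint union of $n$ copies of $S$). The complexes. - $\widehat{\mathcal P}_3\subset 2^S$, where $S$ is the set of the $7$ points of the Fano plane (the projective plane over the field with two elements): $A\in\widehat{\mathcal P}_3$ iff $A$ does not contain a line ($\mathcal P_3$ denotes the $3$-uniform hypergraph of the $7$ lines). - $[3]$ is the $0$-dimensional complex $\{\emptyset,\{1\},\{2\},\{3\}\}\subset 2^{[3]}$ of three points. - $\mathbb{R}P^2_6$ is the $6$-vertex triangulation of the real projective plane, i.e. the quotient of the boundary complex of the icosahedron by the antipodal map. - $\mathbb{C}P^2_9$ is the (Kühnel–Banchoff) $9$-vertex triangulation of the complex projective plane $\mathbb{C}P^2$, which has a vertex-transitive group of simplicial automorphisms. - $\mathbb{H}P^2_{15}=M^8_{15}$ is the $15$-vertex triangulation of the quaternionic projective plane $\mathbb{H}P^2$ constructed by Brehm and Kühnel which is invariant under a vertex-transitive action of the alternating group $A_5$. In the last three cases $S$ is the vertex set. - $\mathfrak{R}_3\subset 2^{V}$, where $V$ is the set of the $15$ edges of the complete graph $K_6$: a set of edges $\Gamma\subseteq V$ is in $\mathfrak{R}_3$ iff the complement $V\setminus\Gamma$ contains the three edges of a triangle. *)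

theory Defs
  imports
    Complex_Main
    "HOL-Library.Extended_Nonnegative_Real"
    "HOL-Library.Disjoint_Sets"
    "HOL-Library.Z2"
    "HOL-Library.Product_Plus"
    "HOL-Combinatorics.Cycles"
begin

section \<open>Simplicial complexes and their invariants\<close>

text \<open>
  A pair \<open>(S, K)\<close> stands for the complex \<open>K \<subseteq> 2\<^sup>S\<close>. The ground set is part of the data, since
  the invariants depend on it and \<open>K\<close> need not contain every singleton.
\<close>

type_synonym 'a complex_on = "'a set \<times> 'a set set"

definition is_complex :: "'a complex_on \<Rightarrow> bool" where
  "is_complex X \<longleftrightarrow> finite (fst X) \<and> snd X \<subseteq> Pow (fst X) \<and> {} \<in> snd X \<and>
     (\<forall>A\<in>snd X. \<forall>B. B \<subseteq> A \<longrightarrow> B \<in> snd X)"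

text \<open>
  Only \<open>k \<ge> 1\<close> is admitted: a nonempty ground set has no partition into \<open>0\<close> blocks, so that
  \<open>k = 0\<close> would satisfy the condition vacuously.
\<close>

definition partition_number :: "'a complex_on \<Rightarrow> nat" where
  "partition_number X = (LEAST k. k \<ge> 1 \<and>
     (\<forall>A. disjoint_family_on A {..<k} \<and> (\<Union>i<k. A i) = fst X \<longrightarrow> (\<exists>i<k. A i \<in> snd X)))"

definition prob_weights :: "'a set \<Rightarrow> ('a \<Rightarrow> real) set" where
  "prob_weights S = {\<mu>. (\<forall>i\<in>S. 0 \<le> \<mu> i) \<and> (\<Sum>i\<in>S. \<mu> i) = 1}"

definition threshold_sets :: "'a set \<Rightarrow> ('a \<Rightarrow> real) \<Rightarrow> ennreal \<Rightarrow> 'a set set" where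
  "threshold_sets S \<mu> \<alpha> = {A. A \<subseteq> S \<and> ennreal (\<Sum>i\<in>A. \<mu> i) \<le> \<alpha>}"

definition threshold_char :: "'a complex_on \<Rightarrow> ennreal" where
  "threshold_char X =
     Sup {\<alpha>. \<exists>\<mu>\<in>prob_weights (fst X). threshold_sets (fst X) \<mu> \<alpha> \<subseteq> snd X}"

text \<open>
  The conversion \<^const>\<open>enn2real\<close> loses nothing for complexes with nonempty ground set: the uniform
  measure then gives \<open>threshold_char X \<ge> 1 / card (fst X) > 0\<close>, so the reciprocal is finite.
\<close>

definition nonlinearity_gap :: "'a complex_on \<Rightarrow> int" where
  "nonlinearity_gap X = \<lfloor>enn2real (1 / threshold_char X)\<rfloor> + 1 - int (partition_number X)"

definition num_vertices :: "'a complex_on \<Rightarrow> nat" where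
  "num_vertices X = card (fst X)"

text \<open>The join of \<open>n\<close> copies, on the disjoint union \<open>{..<n} \<times> S\<close> of \<open>n\<close> copies of \<open>S\<close>.\<close>

definition join_power :: "'a complex_on \<Rightarrow> nat \<Rightarrow> (nat \<times> 'a) complex_on" where
  "join_power X n =
     ({..<n} \<times> fst X, {(SIGMA i:{..<n}. A i) | A. \<forall>i<n. A i \<in> snd X})"

definition generated_complex :: "'a set set \<Rightarrow> 'a complex_on" where
  "generated_complex F = (\<Union>F, {A. \<exists>B\<in>F. A \<subseteq> B})"


section \<open>The six complexes\<close>

text \<open>
  Over the field with two elements every one-dimensional subspace contains exactly one nonzero
  vector, so the points of the Fano plane are the nonzero vectors of \<open>\<bbbF>\<^sub>2\<^sup>3\<close>, and the lines are the
  sets of nonzero vectors of the two-dimensional subspaces.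
\<close>

definition fano_points :: "(bit \<times> bit \<times> bit) set" where
  "fano_points = {v. v \<noteq> 0}"

definition fano_lines :: "(bit \<times> bit \<times> bit) set set" where
  "fano_lines = {{x, y, x + y} | x y. x \<in> fano_points \<and> y \<in> fano_points \<and> x \<noteq> y}"

definition P3_hat :: "(bit \<times> bit \<times> bit) complex_on" where
  "P3_hat = (fano_points, {A. A \<subseteq> fano_points \<and> \<not> (\<exists>L\<in>fano_lines. L \<subseteq> A)})"

definition three_points :: "nat complex_on" where
  "three_points = ({1, 2, 3}, {{}, {1}, {2}, {3}})"

text \<open>
  The icosahedron has north pole \<open>0\<close>, upper pentagon \<open>1, \<dots>, 5\<close>, lower pentagon \<open>6, \<dots>, 10\<close> and
  south pole \<open>11\<close>; the vertex \<open>6 + i\<close> lies below the edge from \<open>1 + i\<close> to the next vertex of the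
  upper pentagon. The antipode of a vertex is the vertex at graph distance \<open>3\<close>.
\<close>

definition icosahedron_facets :: "nat set set" where
  "icosahedron_facets = {
    {0,1,2}, {0,2,3}, {0,3,4}, {0,4,5}, {0,5,1},
    {1,2,6}, {2,3,7}, {3,4,8}, {4,5,9}, {5,1,10},
    {6,7,2}, {7,8,3}, {8,9,4}, {9,10,5}, {10,6,1},
    {6,7,11}, {7,8,11}, {8,9,11}, {9,10,11}, {10,6,11}}"

definition antipode :: "nat \<Rightarrow> nat" where
  "antipode v = [11, 8, 9, 10, 6, 7, 4, 5, 1, 2, 3, 0] ! v"

definition antipodal_class :: "nat \<Rightarrow> nat set" where
  "antipodal_class v = {v, antipode v}"

definition quotient_complex :: "('a \<Rightarrow> 'b) \<Rightarrow> 'a complex_on \<Rightarrow> 'b complex_on" where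
  "quotient_complex q X = (q ` fst X, (`) q ` snd X)"

definition RP2_6 :: "nat set complex_on" where
  "RP2_6 = quotient_complex antipodal_class (generated_complex icosahedron_facets)"

text \<open>The facets of the Kuehnel--Banchoff triangulation.\<close>

definition CP2_9 :: "nat complex_on" where
  "CP2_9 = generated_complex {
    {1,2,3,7,8}, {1,2,3,7,9}, {1,2,3,8,9}, {1,2,4,5,6},
    {1,2,4,5,9}, {1,2,4,6,7}, {1,2,4,7,9}, {1,2,5,6,8},
    {1,2,5,8,9}, {1,2,6,7,8}, {1,3,4,5,6}, {1,3,4,5,7},
    {1,3,4,6,8}, {1,3,4,7,8}, {1,3,5,6,9}, {1,3,5,7,9},
    {1,3,6,8,9}, {1,4,5,7,9}, {1,4,6,7,8}, {1,5,6,8,9},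
    {2,3,4,5,6}, {2,3,4,5,8}, {2,3,4,6,9}, {2,3,4,8,9},
    {2,3,5,6,7}, {2,3,5,7,8}, {2,3,6,7,9}, {2,4,5,8,9},
    {2,4,6,7,9}, {2,5,6,7,8}, {3,4,5,7,8}, {3,4,6,8,9},
    {3,5,6,7,9}, {4,5,7,8,9}, {4,6,7,8,9}, {5,6,7,8,9}}"

text \<open>
  Brehm and Kuehnel, 15-vertex triangulations of an 8-manifold, Math. Ann. 294 (1992): the two
  permutations below generate a vertex-transitive action of the alternating group \<open>A\<^sub>5\<close> (of order
  \<open>60\<close>), and the \<open>490\<close> facets of \<open>M\<^sup>8\<^sub>1\<^sub>5\<close> are the sets in the orbits of the \<open>14\<close> given ones.
  As the group is finite, its orbits are obtained by closing under the two generators.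
\<close>

definition HP2_perm_P :: "nat \<Rightarrow> nat" where
  "HP2_perm_P = cycle_of_list [1,2,3,4,5] \<circ> cycle_of_list [6,7,8,9,10] \<circ>
     cycle_of_list [11,12,13,14,15]"

definition HP2_perm_S :: "nat \<Rightarrow> nat" where
  "HP2_perm_S = cycle_of_list [1,6,11] \<circ> cycle_of_list [2,15,14] \<circ> cycle_of_list [3,13,8] \<circ>
     cycle_of_list [4,7,5] \<circ> cycle_of_list [9,12,10]"

definition HP2_start_facets :: "nat set set" where
  "HP2_start_facets = {
    {1,2,3,6,8,11,13,14,15}, {1,3,6,8,9,10,11,12,13},
    {1,2,6,9,10,11,12,14,15}, {1,2,3,4,7,9,12,14,15},
    {1,2,4,7,9,10,12,13,14}, {1,2,6,8,9,10,11,14,15},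
    {1,2,3,4,5,6,9,11,13}, {1,3,5,6,8,9,10,11,12},
    {1,3,5,6,7,8,9,10,11}, {1,2,3,4,5,7,10,12,15},
    {1,2,3,7,8,10,12,13,14}, {2,5,6,7,8,9,10,13,14},
    {3,4,6,7,11,12,13,14,15}, {3,4,6,7,10,12,13,14,15}}"

inductive_set HP2_facets :: "nat set set" where
  start: "F \<in> HP2_start_facets \<Longrightarrow> F \<in> HP2_facets"
| P: "F \<in> HP2_facets \<Longrightarrow> HP2_perm_P ` F \<in> HP2_facets"
| S: "F \<in> HP2_facets \<Longrightarrow> HP2_perm_S ` F \<in> HP2_facets"

definition HP2_15 :: "nat complex_on" where
  "HP2_15 = generated_complex HP2_facets"

definition K6_edges :: "nat set set" where
  "K6_edges = {e. e \<subseteq> {1..6} \<and> card e = 2}"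

definition R3 :: "nat set complex_on" where
  "R3 = (K6_edges, {\<Gamma>. \<Gamma> \<subseteq> K6_edges \<and>
     (\<exists>a\<in>{1..6}. \<exists>b\<in>{1..6}. \<exists>c\<in>{1..6}. a \<noteq> b \<and> a \<noteq> c \<and> b \<noteq> c \<and>
        {{a, b}, {a, c}, {b, c}} \<subseteq> K6_edges - \<Gamma>)})"


section \<open>All of these are simplicial complexes\<close>

lemma is_complex_generated:
  assumes "finite (\<Union>F)" "F \<noteq> {}"
  shows "is_complex (generated_complex F)"
  using assms unfolding is_complex_def generated_complex_def by auto

lemma is_complex_quotient:
  assumes "is_complex X"
  shows "is_complex (quotient_complex q X)"
proof -
  have "B \<in> (`) q ` snd X" if A: "A \<in> snd X" and B: "B \<subseteq> q ` A" for A B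
  proof -
    obtain C where "C \<subseteq> A" "B = q ` C" using B by (auto simp: subset_image_iff)
    then show ?thesis using A assms unfolding is_complex_def by blast
  qed
  then show ?thesis
    using assms unfolding is_complex_def by (simp add: quotient_complex_def) blast
qed

lemma is_complex_join_power:
  assumes "is_complex X"
  shows "is_complex (join_power X n)"
proof -
  have "B \<in> snd (join_power X n)"
    if A: "\<forall>i<n. A i \<in> snd X" and B: "B \<subseteq> (SIGMA i:{..<n}. A i)" for A B
  proof -
    have "B = (SIGMA i:{..<n}. B `` {i})" using B by auto
    moreover have "\<forall>i<n. B `` {i} \<in> snd X"
    proof (intro allI impI)
      fix i assume "i < n"
      moreover have "B `` {i} \<subseteq> A i" using B by auto
      ultimately show "B `` {i} \<in> snd X" using A assms unfolding is_complex_def by blast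
    qed
    ultimately show ?thesis unfolding join_power_def by auto
  qed
  moreover have "{} \<in> snd (join_power X n)"
    using assms unfolding is_complex_def join_power_def by (auto intro!: exI[of _ "\<lambda>_. {}"])
  ultimately show ?thesis
    using assms unfolding is_complex_def by (auto simp: join_power_def)
qed

lemma is_complex_P3_hat: "is_complex P3_hat"
proof -
  have "(UNIV :: bit set) = {0, 1}" by (auto simp: bit_not_zero_iff)
  then have "finite (UNIV :: bit set)" by (metis finite.emptyI finite_insert)
  then have "finite (UNIV :: (bit \<times> bit \<times> bit) set)" by (simp add: finite_Prod_UNIV)
  then have "finite fano_points" by (rule rev_finite_subset) simp
  moreover have "{} \<notin> fano_lines" unfolding fano_lines_def by blast
  ultimately show ?thesis unfolding is_complex_def P3_hat_def by (simp del: split_paired_All split_paired_Ex) blast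
qed

lemma is_complex_three_points: "is_complex three_points"
  unfolding is_complex_def three_points_def by (auto simp: subset_singleton_iff)

lemma is_complex_RP2_6: "is_complex RP2_6"
  unfolding RP2_6_def icosahedron_facets_def
  by (intro is_complex_quotient is_complex_generated) simp_all

lemma is_complex_CP2_9: "is_complex CP2_9"
  unfolding CP2_9_def by (rule is_complex_generated) simp_all

lemma is_complex_HP2_15: "is_complex HP2_15"
proof -
  have cyc: "cycle_of_list cs permutes {1..15}" if "set cs \<subseteq> {1..15}" for cs :: "nat list"
    using cycle_permutes that by (rule permutes_subset)
  have P: "HP2_perm_P ` {1..15} \<subseteq> {1..15}" and S: "HP2_perm_S ` {1..15} \<subseteq> {1..15}"
    unfolding HP2_perm_P_def HP2_perm_S_def
    by (rule equalityD1, rule permutes_image, intro permutes_compose cyc; simp)+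
  have "F \<subseteq> {1..15}" if "F \<in> HP2_facets" for F
    using that
  proof induction
    case (start F)
    then show ?case unfolding HP2_start_facets_def by auto
  qed (use P S in blast)+
  then have "finite (\<Union>HP2_facets)" by (meson Sup_least finite_atLeastAtMost finite_subset)
  moreover have "HP2_facets \<noteq> {}"
    using HP2_facets.start unfolding HP2_start_facets_def by auto
  ultimately show ?thesis unfolding HP2_15_def by (rule is_complex_generated)
qed

lemma is_complex_R3: "is_complex R3"
proof -
  have "finite K6_edges"
    by (rule finite_subset[of _ "Pow {1..6}"]) (auto simp: K6_edges_def)
  moreover have "{{1, 2}, {1, 3}, {2, 3}} \<subseteq> K6_edges - {}" by (auto simp: K6_edges_def)
  then have "\<exists>a\<in>{1..6}. \<exists>b\<in>{1..6}. \<exists>c\<in>{1..6}. a \<noteq> b \<and> a \<noteq> c \<and> b \<noteq> c \<and>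
      {{a, b}, {a, c}, {b, c}} \<subseteq> K6_edges - {}"
    by (intro bexI[of _ 1] bexI[of _ 2] bexI[of _ 3]) auto
  ultimately show ?thesis unfolding is_complex_def R3_def by simp blast
qed

end

theory Submission imports Defs begin

text \<open>
  In all six complexes two disjoint subsets of the ground set are never both nonfaces. In the join
  of \<open>n\<close> copies each copy therefore spoils at most one block of a partition, which gives
  \<open>\<pi> = n + 1\<close>. If some family of \<open>m\<close>-element nonfaces covers every vertex equally often, averaging
  over the family and over the copies bounds \<open>\<rho>\<close> from above by \<open>m / (w n)\<close>; if all sets with fewer
  than \<open>m\<close> elements are faces, the uniform measure attains this bound. The latter holds as soon as
  every face has at most \<open>w - m\<close> vertices, because the complement of a set with fewer than \<open>m\<close>
  elements is then a nonface.

  For \<open>\<real>P\<^sup>2\<^sub>6\<close>, \<open>\<complex>P\<^sup>2\<^sub>9\<close> and \<open>\<bbbH>P\<^sup>2\<^sub>1\<^sub>5\<close> the disjointness property is decided by a search over all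
  bipartitions, with the facets stored in a binary trie; for \<open>R\<^sub>3\<close> it says that every
  \<open>2\<close>-colouring of the edges of \<open>K\<^sub>6\<close> has a monochromatic triangle.
\<close>

section \<open>Joins of complexes with intersecting nonfaces\<close>

text \<open>For a complex this means partition number 2: downward closure passes from bipartitions
  to disjoint pairs, and \<open>fst X \<notin> snd X\<close> excludes the value 1.\<close>

definition two_block :: "'a complex_on \<Rightarrow> bool" where
  "two_block X \<longleftrightarrow> is_complex X \<and> fst X \<notin> snd X \<and>
     (\<forall>A B. A \<subseteq> fst X \<longrightarrow> B \<subseteq> fst X \<longrightarrow> A \<inter> B = {} \<longrightarrow> A \<in> snd X \<or> B \<in> snd X)"

lemma two_block_finite: "two_block X \<Longrightarrow> finite (fst X)"
  by (simp add: two_block_def is_complex_def)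

lemma fst_join_power [simp]: "fst (join_power X n) = {..<n} \<times> fst X"
  by (simp add: join_power_def)

lemma mem_join_power_iff:
  assumes "B \<subseteq> {..<n} \<times> fst X"
  shows "B \<in> snd (join_power X n) \<longleftrightarrow> (\<forall>i<n. B `` {i} \<in> snd X)"
proof
  assume "B \<in> snd (join_power X n)"
  then obtain A where A: "B = (SIGMA i:{..<n}. A i)" "\<forall>i<n. A i \<in> snd X"
    by (auto simp: join_power_def)
  have "B `` {i} = A i" if "i < n" for i using that A(1) by auto
  with A(2) show "\<forall>i<n. B `` {i} \<in> snd X" by simp
next
  assume "\<forall>i<n. B `` {i} \<in> snd X"
  moreover have "B = (SIGMA i:{..<n}. B `` {i})" using assms by auto
  ultimately show "B \<in> snd (join_power X n)" by (auto simp: join_power_def)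
qed

lemma partition_number_join_power:
  assumes X: "two_block X" and n: "n \<ge> 1"
  shows "partition_number (join_power X n) = n + 1"
  unfolding partition_number_def
proof (rule Least_equality)
  have "\<exists>i<n+1. A i \<in> snd (join_power X n)"
    if A: "disjoint_family_on A {..<n+1}" "(\<Union>i<n+1. A i) = {..<n} \<times> fst X" for A
  proof (rule ccontr)
    assume neg: "\<not> ?thesis"
    have sub: "A i \<subseteq> {..<n} \<times> fst X" if "i < n + 1" for i using A(2) that by blast
    have "\<forall>i\<in>{..<n+1}. \<exists>j. j < n \<and> A i `` {j} \<notin> snd X"
      using neg mem_join_power_iff[OF sub] by auto
    \<comment> \<open>\<open>j i\<close> is a copy in which the slice of block \<open>i\<close> is a
      nonface; two of the \<open>n + 1\<close> blocks must share such a copy.\<close>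
    then obtain j where j: "\<And>i. i < n + 1 \<Longrightarrow> j i < n \<and> A i `` {j i} \<notin> snd X" by (metis lessThan_iff)
    have "\<not> inj_on j {..<n+1}"
    proof
      assume "inj_on j {..<n+1}"
      moreover have "j ` {..<n+1} \<subseteq> {..<n}" using j by auto
      ultimately have "card {..<n+1} \<le> card {..<n}" by (intro card_inj_on_le) auto
      then show False by simp
    qed
    then obtain a b where ab: "a < n + 1" "b < n + 1" "a \<noteq> b" "j a = j b"
      by (auto simp: inj_on_def)
    have "A a \<inter> A b = {}" using A(1) ab by (auto simp: disjoint_family_on_def)
    then have "A a `` {j a} \<inter> A b `` {j a} = {}" by blast
    moreover have "A a `` {j a} \<subseteq> fst X" "A b `` {j a} \<subseteq> fst X" using sub ab by blast+
    ultimately show False using X j[OF ab(1)] j[OF ab(2)] ab(4) unfolding two_block_def by metis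
  qed
  then show "n + 1 \<ge> 1 \<and> (\<forall>A. disjoint_family_on A {..<n+1} \<and> (\<Union>i<n+1. A i) = fst (join_power X n) \<longrightarrow>
      (\<exists>i<n+1. A i \<in> snd (join_power X n)))"
    by simp
next
  fix k :: nat
  assume k: "k \<ge> 1 \<and> (\<forall>A. disjoint_family_on A {..<k} \<and> (\<Union>i<k. A i) = fst (join_power X n) \<longrightarrow>
      (\<exists>i<k. A i \<in> snd (join_power X n)))"
  show "n + 1 \<le> k"
  proof (rule ccontr)
    assume "\<not> n + 1 \<le> k"
    then have kn: "k \<le> n" by simp
    \<comment> \<open>Block \<open>i\<close> contains the whole copy \<open>i\<close>, and the last
      block \<open>k - 1\<close> also takes the remaining copies, so no block is a face.\<close>
    define A where "A i = {j. j < n \<and> min j (k - 1) = i} \<times> fst X" for i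
    have "disjoint_family_on A {..<k}" by (auto simp: disjoint_family_on_def A_def)
    moreover have "(\<Union>i<k. A i) = {..<n} \<times> fst X" using k by (auto simp: A_def)
    ultimately obtain i where i: "i < k" "A i \<in> snd (join_power X n)" using k by auto
    have "A i \<subseteq> {..<n} \<times> fst X" by (auto simp: A_def)
    with i kn have "A i `` {i} \<in> snd X" by (simp add: mem_join_power_iff)
    moreover have "A i `` {i} = fst X" using i kn by (auto simp: A_def)
    ultimately show False using X by (simp add: two_block_def)
  qed
qed

section \<open>Bounds for the threshold characteristic of joins\<close>

text \<open>Equal weights on the list form a dual certificate for the linear program behind
  \<open>threshold_char\<close>: maximise over all measures the least measure of a nonface.\<close>

definition nonface_cover :: "'a complex_on \<Rightarrow> 'a set list \<Rightarrow> nat \<Rightarrow> bool" where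
  "nonface_cover X As r \<longleftrightarrow> (\<forall>A\<in>set As. A \<subseteq> fst X \<and> A \<notin> snd X) \<and>
     (\<forall>v\<in>fst X. length (filter (\<lambda>A. v \<in> A) As) = r)"

text \<open>Double counting of the incidences \<open>v \<in> A\<close>, weighted by
  \<open>f\<close>.\<close>

lemma sum_list_sum_sets:
  fixes f :: "'a \<Rightarrow> real"
  assumes "finite S" "\<forall>A\<in>set As. A \<subseteq> S"
  shows "(\<Sum>A\<leftarrow>As. sum f A) = (\<Sum>v\<in>S. real (length (filter (\<lambda>A. v \<in> A) As)) * f v)"
  using assms(2)
proof (induction As)
  case (Cons A As)
  have "sum f A = (\<Sum>v\<in>S. if v \<in> A then f v else 0)"
    using Cons.prems assms(1) by (simp add: sum.If_cases Int_absorb1)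
  then have "(\<Sum>A\<leftarrow>A # As. sum f A) =
      (\<Sum>v\<in>S. (if v \<in> A then f v else 0) + real (length (filter (\<lambda>A. v \<in> A) As)) * f v)"
    using Cons by (simp add: sum.distrib)
  also have "\<dots> = (\<Sum>v\<in>S. real (length (filter (\<lambda>B. v \<in> B) (A # As))) * f v)"
    by (rule sum.cong) (auto simp: algebra_simps)
  finally show ?case .
qed simp

text \<open>The average of the measures of the sets \<open>{j} \<times> A\<close>, \<open>j < n\<close>, \<open>A \<in> As\<close>, is \<open>r / (n * length As)\<close>.\<close>

lemma threshold_char_join_power_le:
  assumes X: "finite (fst X)" and cov: "nonface_cover X As r" and As: "As \<noteq> []" and n: "n \<ge> 1"
  shows "threshold_char (join_power X n) \<le> ennreal (real r / (real (length As) * real n))"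
  unfolding threshold_char_def
proof (rule Sup_least, clarsimp)
  fix \<alpha> \<mu>
  assume \<mu>: "\<mu> \<in> prob_weights ({..<n} \<times> fst X)"
    and thr: "threshold_sets ({..<n} \<times> fst X) \<mu> \<alpha> \<subseteq> snd (join_power X n)"
  define c where "c = real r / (real (length As) * real n)"
  have N: "length As > 0" using As by simp
  have "\<exists>j<n. \<exists>A\<in>set As. (\<Sum>v\<in>A. \<mu> (j, v)) \<le> c"
  proof (rule ccontr)
    assume neg: "\<not> ?thesis"
    \<comment> \<open>Otherwise the total over all copies and list entries would exceed
      \<open>r\<close>, whereas double counting makes it equal to \<open>r\<close>.\<close>
    have "real r = (\<Sum>j<n. real (length As) * c)"
      using N n by (simp add: c_def)
    also have "\<dots> < (\<Sum>j<n. \<Sum>A\<leftarrow>As. \<Sum>v\<in>A. \<mu> (j, v))"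
    proof (rule sum_strict_mono)
      fix j assume "j \<in> {..<n}"
      then have "\<And>A. A \<in> set As \<Longrightarrow> c < (\<Sum>v\<in>A. \<mu> (j, v))" using neg by force
      then have "(\<Sum>A\<leftarrow>As. c) < (\<Sum>A\<leftarrow>As. \<Sum>v\<in>A. \<mu> (j, v))"
        using As by (intro sum_list_strict_mono) auto
      then show "real (length As) * c < (\<Sum>A\<leftarrow>As. \<Sum>v\<in>A. \<mu> (j, v))"
        by (simp add: sum_list_triv)
    qed (use n in \<open>auto simp: lessThan_empty_iff\<close>)
    also have "\<dots> = (\<Sum>j<n. \<Sum>v\<in>fst X. real r * \<mu> (j, v))"
    proof (rule sum.cong)
      fix j
      have "\<forall>A\<in>set As. A \<subseteq> fst X" using cov by (simp add: nonface_cover_def)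
      from sum_list_sum_sets[OF X this, of "\<lambda>v. \<mu> (j, v)"]
      show "(\<Sum>A\<leftarrow>As. \<Sum>v\<in>A. \<mu> (j, v)) = (\<Sum>v\<in>fst X. real r * \<mu> (j, v))"
        using cov by (simp add: nonface_cover_def)
    qed simp
    also have "\<dots> = real r * sum \<mu> ({..<n} \<times> fst X)"
      by (simp add: sum.cartesian_product sum_distrib_left)
    also have "\<dots> = real r" using \<mu> by (simp add: prob_weights_def)
    finally show False by simp
  qed
  then obtain j A where jA: "j < n" "A \<in> set As" "(\<Sum>v\<in>A. \<mu> (j, v)) \<le> c" by blast
  have sub: "{j} \<times> A \<subseteq> {..<n} \<times> fst X" and nA: "A \<notin> snd X"
    using jA cov by (auto simp: nonface_cover_def)
  have "({j} \<times> A) `` {j} = A" by auto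
  then have "{j} \<times> A \<notin> snd (join_power X n)" using nA jA mem_join_power_iff[OF sub] by metis
  then have "\<not> ennreal (sum \<mu> ({j} \<times> A)) \<le> \<alpha>" using thr sub by (auto simp: threshold_sets_def)
  moreover have "sum \<mu> ({j} \<times> A) = (\<Sum>v\<in>A. \<mu> (j, v))"
    using sum.cartesian_product[of "\<lambda>i v. \<mu> (i, v)" A "{j}"] by simp
  ultimately have "\<alpha> < ennreal (\<Sum>v\<in>A. \<mu> (j, v))" by simp
  also have "\<dots> \<le> ennreal c" using jA(3) by (rule ennreal_leI)
  finally show "\<alpha> \<le> ennreal (real r / (real (length As) * real n))" by (simp add: c_def)
qed

lemma threshold_char_join_power_ge:
  assumes X: "finite (fst X)" and ne: "fst X \<noteq> {}" and n: "n \<ge> 1"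
    and small: "\<And>A. A \<subseteq> fst X \<Longrightarrow> card A < m \<Longrightarrow> A \<in> snd X"
  shows "ennreal (real m / (real (card (fst X)) * real n)) \<le> threshold_char (join_power X n)"
\<comment> \<open>Threshold sets are defined with \<open>\<le>\<close>, so at the bound itself they
  include sets with \<open>m\<close> elements; every smaller \<open>\<alpha>\<close> is admissible
  for the uniform measure.\<close>
proof (rule dense_le)
  fix \<alpha> assume \<alpha>: "\<alpha> < ennreal (real m / (real (card (fst X)) * real n))"
  define w where "w = real (card (fst X)) * real n"
  have w: "w > 0" using X ne n by (simp add: w_def card_gt_0_iff)
  define \<mu> :: "nat \<times> 'a \<Rightarrow> real" where "\<mu> = (\<lambda>_. 1 / w)"
  have "\<mu> \<in> prob_weights ({..<n} \<times> fst X)"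
    using X ne n by (simp add: prob_weights_def \<mu>_def w_def card_cartesian_product card_eq_0_iff)
  moreover have "threshold_sets ({..<n} \<times> fst X) \<mu> \<alpha> \<subseteq> snd (join_power X n)"
  proof
    fix B assume "B \<in> threshold_sets ({..<n} \<times> fst X) \<mu> \<alpha>"
    then have B: "B \<subseteq> {..<n} \<times> fst X" and "ennreal (real (card B) / w) \<le> \<alpha>"
      by (simp_all add: threshold_sets_def \<mu>_def)
    with \<alpha> have "ennreal (real (card B) / w) < ennreal (real m / w)" by (simp add: w_def)
    then have cB: "card B < m" using w by (simp add: ennreal_less_iff divide_less_cancel)
    have "finite B" using B X finite_subset by blast
    have "B `` {i} \<in> snd X" for i
    proof (rule small)
      have "card (B `` {i}) = card ({i} \<times> B `` {i})" by (simp add: card_cartesian_product_singleton)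
      also have "\<dots> \<le> card B" by (rule card_mono[OF \<open>finite B\<close>]) auto
      finally show "card (B `` {i}) < m" using cB by simp
    qed (use B in auto)
    then show "B \<in> snd (join_power X n)" by (simp add: mem_join_power_iff[OF B])
  qed
  ultimately show "\<alpha> \<le> threshold_char (join_power X n)"
    unfolding threshold_char_def by (intro Sup_upper) auto
qed

section \<open>Complexes for which the two bounds agree\<close>

text \<open>The equation \<open>r * w = length As * m\<close> makes the upper bound
  \<open>r / (length As * n)\<close> from the cover equal to the lower bound
  \<open>m / (w * n)\<close> from the uniform measure.\<close>

definition balanced :: "'a complex_on \<Rightarrow> nat \<Rightarrow> nat \<Rightarrow> bool" where
  "balanced X w m \<longleftrightarrow> two_block X \<and> card (fst X) = w \<and> 0 < w \<and> 0 < m \<and>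
     (\<forall>A. A \<subseteq> fst X \<longrightarrow> card A < m \<longrightarrow> A \<in> snd X) \<and>
     (\<exists>As r. As \<noteq> [] \<and> nonface_cover X As r \<and> r * w = length As * m)"

lemma balancedI:
  assumes X: "two_block X" and S: "card (fst X) = w" and "0 < m" and mw: "m \<le> w"
    and dim: "\<And>A. A \<in> snd X \<Longrightarrow> card A \<le> w - m"
    and cov: "nonface_cover X As r" "As \<noteq> []" "r * w = length As * m"
  shows "balanced X w m"
proof -
  have "A \<in> snd X" if A: "A \<subseteq> fst X" "card A < m" for A
  proof -
    \<comment> \<open>The complement has more than \<open>w - m\<close> elements, so it is not a
      face, and \<open>two_block\<close> then makes \<open>A\<close> one.\<close>
    have "card (fst X - A) = w - card A"
      using A S two_block_finite[OF X] by (simp add: card_Diff_subset finite_subset)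
    then have "fst X - A \<notin> snd X" using A mw dim[of "fst X - A"] by auto
    then show ?thesis using X A unfolding two_block_def by (metis Diff_disjoint Diff_subset)
  qed
  then show ?thesis using assms unfolding balanced_def by auto
qed

lemma num_vertices_join_power: "card (fst X) = w \<Longrightarrow> num_vertices (join_power X n) = w * n"
  by (simp add: num_vertices_def card_cartesian_product)

lemma balanced_card: "balanced X w m \<Longrightarrow> card (fst X) = w"
  and balanced_two_block: "balanced X w m \<Longrightarrow> two_block X"
  by (simp_all add: balanced_def)

lemma threshold_char_join_power:
  assumes X: "balanced X w m" and n: "n \<ge> 1"
  shows "threshold_char (join_power X n) = ennreal (real m / (real w * real n))"
proof (rule antisym)
  have fin: "finite (fst X)" and ne: "fst X \<noteq> {}"
    using X by (auto simp: balanced_def card_gt_0_iff)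
  obtain As r where As: "As \<noteq> []" "nonface_cover X As r" and eq: "r * w = length As * m"
    using X by (auto simp: balanced_def)
  have "real r * real w = real (length As) * real m" using eq by (metis of_nat_mult)
  then have "real r / (real (length As) * real n) = real m / (real w * real n)"
    using X As(1) n by (simp add: balanced_def field_simps)
  with threshold_char_join_power_le[OF fin As(2,1) n]
  show "threshold_char (join_power X n) \<le> ennreal (real m / (real w * real n))" by simp
  show "ennreal (real m / (real w * real n)) \<le> threshold_char (join_power X n)"
    using threshold_char_join_power_ge[OF fin ne n, of m] X by (simp add: balanced_def)
qed

lemma nonlinearity_gap_join_power:
  assumes X: "balanced X w m" and n: "n \<ge> 1"
  shows "nonlinearity_gap (join_power X n) = \<lfloor>(real w / real m - 1) * real n\<rfloor>"
proof -
  have "0 < real m / (real w * real n)" using X n by (simp add: balanced_def)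
  then have "1 / threshold_char (join_power X n) = ennreal (1 / (real m / (real w * real n)))"
    unfolding threshold_char_join_power[OF assms] ennreal_1[symmetric] by (intro divide_ennreal) auto
  \<comment> \<open>The integer \<open>n\<close> is split off so that it leaves the floor and
    cancels against \<open>1 - (n + 1)\<close>.\<close>
  then have "enn2real (1 / threshold_char (join_power X n)) = (real w / real m - 1) * real n + of_int (int n)"
    by (simp add: algebra_simps)
  then show ?thesis
    using partition_number_join_power[OF balanced_two_block[OF X] n]
    by (simp add: nonlinearity_gap_def)
qed

lemma tendsto_floor_mult_div:
  "(\<lambda>n. real_of_int \<lfloor>c * real n\<rfloor> / real n) \<longlonglongrightarrow> c"
proof (rule tendsto_sandwich)
  show "eventually (\<lambda>n. c - 1 / real n \<le> real_of_int \<lfloor>c * real n\<rfloor> / real n) sequentially"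
  proof (rule eventually_sequentiallyI)
    fix n :: nat assume "1 \<le> n"
    moreover have "(c * real n - 1) / real n \<le> real_of_int \<lfloor>c * real n\<rfloor> / real n"
      by (intro divide_right_mono) linarith+
    ultimately show "c - 1 / real n \<le> real_of_int \<lfloor>c * real n\<rfloor> / real n"
      by (simp add: diff_divide_distrib)
  qed
  show "eventually (\<lambda>n. real_of_int \<lfloor>c * real n\<rfloor> / real n \<le> c) sequentially"
    by (rule eventually_sequentiallyI[of 1]) (simp add: field_simps)
  have "(\<lambda>n. c - 1 / real n) \<longlonglongrightarrow> c - 0"
    by (intro tendsto_intros lim_1_over_n)
  then show "(\<lambda>n. c - 1 / real n) \<longlonglongrightarrow> c" by simp
qed simp

lemma gap_ratio_join_power_tendsto:
  assumes X: "balanced X w m"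
  shows "(\<lambda>n. real_of_int (nonlinearity_gap (join_power X n)) / real (num_vertices (join_power X n)))
    \<longlonglongrightarrow> 1 / real m - 1 / real w"
proof -
  let ?c = "real w / real m - 1"
  have "(\<lambda>n. real_of_int \<lfloor>?c * real n\<rfloor> / real n / real w) \<longlonglongrightarrow> ?c / real w"
    by (intro tendsto_divide tendsto_floor_mult_div tendsto_const) (use X in \<open>simp add: balanced_def\<close>)
  moreover have "?c / real w = 1 / real m - 1 / real w"
    using X by (simp add: balanced_def field_simps)
  moreover have "eventually (\<lambda>n. real_of_int \<lfloor>?c * real n\<rfloor> / real n / real w =
      real_of_int (nonlinearity_gap (join_power X n)) / real (num_vertices (join_power X n))) sequentially"
    by (rule eventually_sequentiallyI[of 1])
      (simp add: nonlinearity_gap_join_power[OF X] num_vertices_join_power[OF balanced_card[OF X]] mult.commute)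
  ultimately show ?thesis by (simp add: tendsto_cong)
qed

section \<open>Deciding bipartitions by a facet trie\<close>

text \<open>
  A trie stores a set of facets along a list of vertices: the two subtries of a \<open>Branch\<close> hold the
  facets without and with the next vertex, and \<open>Full\<close> stands for a facet that contains all remaining
  vertices.
\<close>

datatype facet_trie = Empty | Full | Branch facet_trie facet_trie

text \<open>A \<open>Branch\<close> with no vertex left is too deep for the vertex list; by default
  it accepts nothing.\<close>

fun trie_face :: "facet_trie \<Rightarrow> 'a list \<Rightarrow> 'a set \<Rightarrow> bool" where
  "trie_face Empty vs A \<longleftrightarrow> False"
| "trie_face Full vs A \<longleftrightarrow> True"
| "trie_face (Branch t u) [] A \<longleftrightarrow> False"
| "trie_face (Branch t u) (v # vs) A \<longleftrightarrow> trie_face u vs A \<or> v \<notin> A \<and> trie_face t vs A"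

text \<open>Recognising \<open>Full\<close> as early as possible is what prunes the search below.\<close>

fun branch :: "facet_trie \<Rightarrow> facet_trie \<Rightarrow> facet_trie" where
  "branch Empty Full = Full"
| "branch t u = Branch t u"

text \<open>A right subtrie \<open>Full\<close> accepts every set, with or without \<open>v\<close>,
  so the collapse is harmless as long as a vertex is left.\<close>

lemma trie_face_branch: "trie_face (branch t u) (v # vs) A = trie_face (Branch t u) (v # vs) A"
  by (cases "(t, u)" rule: branch.cases) auto

fun insert_facet :: "bool list \<Rightarrow> facet_trie \<Rightarrow> facet_trie" where
  "insert_facet [] t = Full"
| "insert_facet (b # bs) Empty =
     (if b then branch Empty (insert_facet bs Empty) else Branch (insert_facet bs Empty) Empty)"
| "insert_facet (b # bs) Full = Full"
| "insert_facet (b # bs) (Branch t u) =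
     (if b then branch t (insert_facet bs u) else Branch (insert_facet bs t) u)"

text \<open>Soundness of insertion, the direction that turns a successful search into a
  face.\<close>

lemma trie_face_insert_facet:
  assumes "trie_face (insert_facet (map (\<lambda>v. v \<in> F) vs) t) vs A"
  shows "trie_face t vs A \<or> A \<inter> set vs \<subseteq> F"
  using assms
proof (induction vs arbitrary: t)
  case (Cons v vs)
  show ?case
  proof (cases t)
    case Empty
    then show ?thesis
      using Cons.prems Cons.IH[of Empty] by (auto simp: trie_face_branch split: if_splits)
  next
    case (Branch a b)
    then show ?thesis
      using Cons.prems Cons.IH[of a] Cons.IH[of b] by (auto simp: trie_face_branch split: if_splits)
  qed simp
qed simp

fun union_trie :: "facet_trie \<Rightarrow> facet_trie \<Rightarrow> facet_trie" where
  "union_trie Empty u = u"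
| "union_trie Full u = Full"
| "union_trie (Branch a b) Empty = Branch a b"
| "union_trie (Branch a b) Full = Full"
| "union_trie (Branch a b) (Branch c d) = Branch (union_trie a c) (union_trie b d)"

lemma trie_face_union_trie:
  "trie_face (union_trie t u) vs A \<longleftrightarrow> trie_face t vs A \<or> trie_face u vs A"
proof (induction t u arbitrary: vs rule: union_trie.induct)
  case (5 a b c d)
  then show ?case by (cases vs) auto
qed auto

text \<open>
  The two tries hold the facets that contain the first and the second part of a partial bipartition.
  Putting a vertex into one part is no restriction on the facets for the other part, so there the two
  subtries are merged.
\<close>

fun search_bipartitions :: "'a list \<Rightarrow> facet_trie \<Rightarrow> facet_trie \<Rightarrow> bool" where
  "search_bipartitions vs Full u = True"
| "search_bipartitions vs Empty u = (u = Full)"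
| "search_bipartitions vs (Branch a b) Full = True"
| "search_bipartitions vs (Branch a b) Empty = False"
| "search_bipartitions [] (Branch a b) (Branch c d) = False"
| "search_bipartitions (v # vs) (Branch a b) (Branch c d) =
     (if search_bipartitions vs b (union_trie c d)
      then search_bipartitions vs (union_trie a b) d else False)"

lemma search_bipartitions_trie_face:
  assumes "search_bipartitions vs t u" "A \<inter> B = {}"
  shows "trie_face t vs A \<or> trie_face u vs B"
  using assms
proof (induction vs t u rule: search_bipartitions.induct)
  case (6 v vs a b c d)
  \<comment> \<open>If \<open>v \<notin> B\<close>, the first recursive call applies: it asks for a
    facet for \<open>A\<close> that contains \<open>v\<close>, which also serves when
    \<open>v \<notin> A\<close>. If \<open>v \<in> B\<close>, the second one applies.\<close>
  then show ?case by (cases "v \<in> B") (auto simp: trie_face_union_trie split: if_splits)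
qed auto

lemma trie_face_fold:
  assumes "trie_face (fold insert_facet bss t) vs A"
    "\<And>bs. bs \<in> set bss \<Longrightarrow> \<exists>F\<in>\<F>. bs = map (\<lambda>v. v \<in> F) vs"
  shows "trie_face t vs A \<or> (\<exists>F\<in>\<F>. A \<inter> set vs \<subseteq> F)"
  using assms
proof (induction bss arbitrary: t)
  case (Cons bs bss)
  obtain F where "F \<in> \<F>" "bs = map (\<lambda>v. v \<in> F) vs" using Cons.prems(2)[of bs] by auto
  with Cons trie_face_insert_facet[of F vs t A] show ?case by auto
qed simp

text \<open>Each vector is only asked to come from some member of \<open>\<F>\<close>, so any list
  of facets on which the search succeeds will do.\<close>

lemma two_block_generatedI:
  assumes search:
    "search_bipartitions vs (fold insert_facet bss Empty) (fold insert_facet bss Empty)"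
    and bss: "\<And>bs. bs \<in> set bss \<Longrightarrow> \<exists>F\<in>\<F>. bs = map (\<lambda>v. v \<in> F) vs"
    and \<F>: "\<Union>\<F> = set vs" "\<F> \<noteq> {}" "set vs \<notin> \<F>"
  shows "two_block (generated_complex \<F>)"
proof -
  have face: "A \<in> snd (generated_complex \<F>)"
    if "A \<subseteq> set vs" "trie_face (fold insert_facet bss Empty) vs A" for A
    using trie_face_fold[OF that(2) bss] that(1) by (auto simp: generated_complex_def Int_absorb2)
  have "fst (generated_complex \<F>) = set vs" using \<F>(1) by (simp add: generated_complex_def)
  moreover have "is_complex (generated_complex \<F>)"
    using \<F> by (intro is_complex_generated) simp_all
  moreover have "set vs \<notin> snd (generated_complex \<F>)"
  proof
    assume "set vs \<in> snd (generated_complex \<F>)"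
    then obtain F where "F \<in> \<F>" "set vs \<subseteq> F" by (auto simp: generated_complex_def)
    with \<F>(1) have "F = set vs" by blast
    with \<open>F \<in> \<F>\<close> \<F>(3) show False by simp
  qed
  ultimately show ?thesis
    unfolding two_block_def using search_bipartitions_trie_face[OF search] face by metis
qed

text \<open>Collects the finite checks for a triangulation with facets of equal size: search, facet
  size and cover.\<close>

lemma balanced_generatedI:
  assumes search:
    "search_bipartitions vs (fold insert_facet bss Empty) (fold insert_facet bss Empty)"
    and bss: "\<And>bs. bs \<in> set bss \<Longrightarrow> \<exists>F\<in>\<F>. bs = map (\<lambda>v. v \<in> F) vs"
    and \<F>: "\<Union>\<F> = set vs" "\<F> \<noteq> {}"
    and vs: "distinct vs" "length vs = w" "0 < m" "m \<le> w"
    and dim: "\<forall>F\<in>\<F>. card F = w - m"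
    and cov: "\<forall>A\<in>set As. A \<subseteq> set vs \<and> (\<forall>F\<in>\<F>. \<not> A \<subseteq> F)"
      "\<forall>v\<in>set vs. length (filter (\<lambda>A. v \<in> A) As) = r"
      "As \<noteq> []" "r * w = length As * m"
  shows "balanced (generated_complex \<F>) w m"
proof (rule balancedI)
  have "set vs \<notin> \<F>" using dim vs by (auto simp: distinct_card)
  with search bss \<F> show "two_block (generated_complex \<F>)" by (rule two_block_generatedI)
  show "card (fst (generated_complex \<F>)) = w"
    using \<F>(1) vs(1,2) by (simp add: generated_complex_def distinct_card)
  show "card A \<le> w - m" if A: "A \<in> snd (generated_complex \<F>)" for A
  proof -
    obtain F where F: "F \<in> \<F>" "A \<subseteq> F" using A by (auto simp: generated_complex_def)
    have "finite F" using F(1) \<F>(1) by (metis Union_upper finite_set finite_subset)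
    then show ?thesis using card_mono[OF _ F(2)] dim F(1) by metis
  qed
  show "nonface_cover (generated_complex \<F>) As r"
    using cov(1,2) \<F>(1) by (auto simp: nonface_cover_def generated_complex_def)
qed (use vs cov in auto)

section \<open>The six complexes\<close>

text \<open>Every nonface has at least two of the three points, so any two nonfaces meet. The three
  pairs form the cover.\<close>

lemma balanced_three_points: "balanced three_points 3 2"
proof (rule balancedI)
  have *: "A = {} \<or> A = {1} \<or> A = {2} \<or> A = {3}" if "A \<subseteq> {1,2,3}" "card A \<le> 1" for A :: "nat set"
    using that by (metis card_le_Suc0_iff_eq card_1_singletonE One_nat_def le_Suc_eq card_0_eq
        finite.emptyI finite_insert finite_subset insert_subset singletonD insertE le_zero_eq)
  have "A \<in> snd three_points \<or> B \<in> snd three_points"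
    if "A \<subseteq> fst three_points" "B \<subseteq> fst three_points" "A \<inter> B = {}" for A B
  proof -
    have AB: "A \<subseteq> {1,2,3}" "B \<subseteq> {1,2,3}" using that by (simp_all add: three_points_def)
    then have "card A + card B = card (A \<union> B)"
      using that(3) by (metis card_Un_disjoint finite.emptyI finite_insert finite_subset)
    also have "\<dots> \<le> card {1,2,3::nat}" by (rule card_mono) (use AB in auto)
    finally have "card A \<le> 1 \<or> card B \<le> 1" by (simp, linarith)
    with *[OF AB(1)] *[OF AB(2)] show ?thesis by (auto simp: three_points_def)
  qed
  then show "two_block three_points"
    by (auto simp: two_block_def is_complex_three_points) (auto simp: three_points_def)
  show "nonface_cover three_points [{1,2}, {1,3}, {2,3}] 2"
    by (auto simp: nonface_cover_def three_points_def doubleton_eq_iff)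
qed (auto simp: three_points_def)

lemma fano_points_eq: "fano_points = {(0,0,1), (0,1,0), (0,1,1), (1,0,0), (1,0,1), (1,1,0), (1,1,1)}"
proof -
  have "(a, b, c) \<in> fano_points \<longleftrightarrow>
      (a, b, c) \<in> {(0,0,1), (0,1,0), (0,1,1), (1,0,0), (1,0,1), (1,1,0), (1,1,1)}" for a b c
    unfolding fano_points_def zero_prod_def by (cases a; cases b; cases c) simp_all
  then show ?thesis by (metis (no_types, lifting) prod_cases3 set_eqI)
qed

definition fano_line_list :: "(bit \<times> bit \<times> bit) set list" where
  "fano_line_list = [
    {(0,0,1), (0,1,0), (0,1,1)}, {(0,0,1), (1,0,0), (1,0,1)}, {(0,0,1), (1,1,0), (1,1,1)},
    {(0,1,0), (1,0,0), (1,1,0)}, {(0,1,0), (1,0,1), (1,1,1)},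
    {(0,1,1), (1,0,0), (1,1,1)}, {(0,1,1), (1,0,1), (1,1,0)}]"

lemma fano_lines_eq: "fano_lines = set fano_line_list"
proof
  have "{x, y, x + y} \<in> set fano_line_list" if "x \<in> fano_points" "y \<in> fano_points" "x \<noteq> y" for x y
    using that unfolding fano_points_eq
    by (elim insertE emptyE; simp add: fano_line_list_def insert_commute)
  then show "fano_lines \<subseteq> set fano_line_list" unfolding fano_lines_def by blast
  have *: "{x, y, z} \<in> fano_lines" if "x \<in> fano_points" "y \<in> fano_points" "x \<noteq> y" "x + y = z" for x y z
    unfolding fano_lines_def using that by (intro CollectI exI[of _ x] exI[of _ y]) simp
  show "set fano_line_list \<subseteq> fano_lines"
    unfolding fano_line_list_def list.set insert_subset
    by (intro conjI empty_subsetI *) (simp_all add: fano_points_eq)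
qed

text \<open>Any two lines of a projective plane meet, hence so do any two nonfaces. The seven lines
  are the cover, three through each point.\<close>

lemma balanced_P3_hat: "balanced P3_hat 7 3"
proof -
  have S: "card (fst P3_hat) = 7" by (simp add: P3_hat_def fano_points_eq)
  have line: "L \<subseteq> fano_points" "card L = 3" if "L \<in> fano_lines" for L
    using that by (auto simp: fano_lines_eq fano_line_list_def fano_points_eq)
  have meet: "L \<inter> M \<noteq> {}" if "L \<in> fano_lines" "M \<in> fano_lines" for L M
    using that unfolding fano_lines_eq fano_line_list_def
    by (simp, elim disjE; simp)
  have "A \<in> snd P3_hat \<or> B \<in> snd P3_hat"
    if "A \<subseteq> fst P3_hat" "B \<subseteq> fst P3_hat" "A \<inter> B = {}" for A B
    using that meet unfolding P3_hat_def by simp blast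
  moreover have "fst P3_hat \<notin> snd P3_hat"
    by (simp add: P3_hat_def fano_lines_eq fano_line_list_def fano_points_eq)
  ultimately have "two_block P3_hat" by (simp add: two_block_def is_complex_P3_hat)
  moreover have "A \<in> snd P3_hat" if "A \<subseteq> fst P3_hat" "card A < 3" for A
  proof -
    have "finite A" using that(1) by (auto simp: P3_hat_def fano_points_eq intro: finite_subset)
    then have "\<not> L \<subseteq> A" if "L \<in> fano_lines" for L
      using card_mono[of A L] line(2)[OF that] \<open>card A < 3\<close> by auto
    then show ?thesis using that by (auto simp: P3_hat_def)
  qed
  moreover have "nonface_cover P3_hat fano_line_list 3"
    unfolding nonface_cover_def
  proof
    show "\<forall>A\<in>set fano_line_list. A \<subseteq> fst P3_hat \<and> A \<notin> snd P3_hat"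
      using line(1) by (auto simp: P3_hat_def fano_lines_eq)
    show "\<forall>v\<in>fst P3_hat. length (filter (\<lambda>A. v \<in> A) fano_line_list) = 3"
      by (simp add: P3_hat_def fano_points_eq fano_line_list_def)
  qed
  moreover have "fano_line_list \<noteq> []" "3 * 7 = length fano_line_list * 3"
    by (simp_all add: fano_line_list_def)
  ultimately show ?thesis using S unfolding balanced_def by (intro conjI exI) auto
qed

section \<open>The real projective plane\<close>

lemma quotient_generated_complex:
  "quotient_complex q (generated_complex \<F>) = generated_complex ((`) q ` \<F>)"
proof -
  have "(`) q ` {A. \<exists>B\<in>\<F>. A \<subseteq> B} = {A. \<exists>B\<in>(`) q ` \<F>. A \<subseteq> B}"
    by (auto simp: subset_image_iff)
  then show ?thesis by (simp add: quotient_complex_def generated_complex_def image_Union)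
qed

text \<open>The letters stand for the antipodal classes of \<open>0\<close> to \<open>5\<close>. The
  twenty sets are the images of the icosahedron facets in their order, so each of the ten triangles
  of \<open>RP2_6\<close> is written twice.\<close>

lemma balanced_hemi_icosahedron:
  assumes "distinct [a, b, c, d, e, f]"
  shows "balanced (generated_complex {
    {a,b,c}, {a,c,d}, {a,d,e}, {a,e,f}, {a,f,b},
    {b,c,e}, {c,d,f}, {d,e,b}, {e,f,c}, {f,b,d},
    {e,f,c}, {f,b,d}, {b,c,e}, {c,d,f}, {d,e,b},
    {e,f,a}, {f,b,a}, {b,c,a}, {c,d,a}, {d,e,a}}) 6 3"
    (is "balanced (generated_complex ?\<F>) 6 3")
proof (rule balanced_generatedI)
  let ?vs = "[a, b, c, d, e, f]"
  let ?Fs = "[{a,b,c}, {a,c,d}, {a,d,e}, {a,e,f}, {a,f,b}, {b,c,e}, {c,d,f}, {d,e,b}, {e,f,c}, {f,b,d}]"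
  let ?bss = "map (\<lambda>F. map (\<lambda>v. v \<in> F) ?vs) ?Fs"
  have neq [simp]: "a \<noteq> b" "a \<noteq> c" "a \<noteq> d" "a \<noteq> e" "a \<noteq> f" "b \<noteq> c" "b \<noteq> d" "b \<noteq> e" "b \<noteq> f"
    "c \<noteq> d" "c \<noteq> e" "c \<noteq> f" "d \<noteq> e" "d \<noteq> f" "e \<noteq> f"
    using assms by auto
  note [simp] = neq[symmetric]
  show "search_bipartitions ?vs (fold insert_facet ?bss Empty) (fold insert_facet ?bss Empty)" by simp
  show "\<Union>?\<F> = set ?vs" by (simp add: insert_commute)
  \<comment> \<open>The cover consists of four of the ten missing triangles.\<close>
  show "\<forall>A\<in>set [{a,b,d}, {a,c,e}, {b,c,f}, {d,e,f}]. A \<subseteq> set ?vs \<and> (\<forall>F\<in>?\<F>. \<not> A \<subseteq> F)"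
    by simp
  show "\<forall>v\<in>set ?vs. length (filter (\<lambda>A. v \<in> A) [{a,b,d}, {a,c,e}, {b,c,f}, {d,e,f}]) = 2"
    by simp
  show "\<forall>F\<in>?\<F>. card F = 6 - 3" by simp
  show "\<exists>F\<in>?\<F>. bs = map (\<lambda>v. v \<in> F) ?vs" if in_bss: "bs \<in> set ?bss" for bs
  proof -
    obtain F where bs: "bs = map (\<lambda>v. v \<in> F) ?vs" and F: "F \<in> set ?Fs"
      using in_bss unfolding set_map by (rule imageE)
    have "set ?Fs \<subseteq> ?\<F>"
      by (simp only: list.set insert_subset empty_subsetI insert_iff simp_thms)
    with F have "F \<in> ?\<F>" by (rule rev_subsetD)
    with bs show ?thesis by (rule bexI)
  qed
qed (use assms in simp_all)

lemma antipodal_class_antipode: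
  "antipodal_class 6 = antipodal_class 4" "antipodal_class 7 = antipodal_class 5"
  "antipodal_class 8 = antipodal_class 1" "antipodal_class 9 = antipodal_class 2"
  "antipodal_class 10 = antipodal_class 3" "antipodal_class 11 = antipodal_class 0"
  by (simp_all add: antipodal_class_def antipode_def insert_commute)

lemma balanced_RP2_6: "balanced RP2_6 6 3"
  unfolding RP2_6_def quotient_generated_complex icosahedron_facets_def
    image_insert image_empty antipodal_class_antipode
  by (rule balanced_hemi_icosahedron) (simp add: antipodal_class_def antipode_def doubleton_eq_iff)

section \<open>The complex projective plane\<close>

definition CP2_9_facets :: "nat set list" where
  "CP2_9_facets = [
    {1,2,3,7,8}, {1,2,3,7,9}, {1,2,3,8,9}, {1,2,4,5,6},
    {1,2,4,5,9}, {1,2,4,6,7}, {1,2,4,7,9}, {1,2,5,6,8},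
    {1,2,5,8,9}, {1,2,6,7,8}, {1,3,4,5,6}, {1,3,4,5,7},
    {1,3,4,6,8}, {1,3,4,7,8}, {1,3,5,6,9}, {1,3,5,7,9},
    {1,3,6,8,9}, {1,4,5,7,9}, {1,4,6,7,8}, {1,5,6,8,9},
    {2,3,4,5,6}, {2,3,4,5,8}, {2,3,4,6,9}, {2,3,4,8,9},
    {2,3,5,6,7}, {2,3,5,7,8}, {2,3,6,7,9}, {2,4,5,8,9},
    {2,4,6,7,9}, {2,5,6,7,8}, {3,4,5,7,8}, {3,4,6,8,9},
    {3,5,6,7,9}, {4,5,7,8,9}, {4,6,7,8,9}, {5,6,7,8,9}]"

lemma balanced_CP2_9: "balanced CP2_9 9 4"
proof -
  let ?vs = "[1,2,3,4,5,6,7,8,9] :: nat list"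
  let ?bss = "map (\<lambda>F. map (\<lambda>v. v \<in> F) ?vs) CP2_9_facets"
  \<comment> \<open>Each of the triples \<open>{1,2,3}\<close>, \<open>{4,5,6}\<close>,
    \<open>{7,8,9}\<close> is extended by every point of the next one in cyclic order; a vertex is
    covered three times through its own triple and once as an added point.\<close>
  let ?As = "[{1,2,3,4}, {1,2,3,5}, {1,2,3,6}, {1,7,8,9}, {2,7,8,9}, {3,7,8,9},
    {4,5,6,7}, {4,5,6,8}, {4,5,6,9}] :: nat set list"
  have "balanced (generated_complex (set CP2_9_facets)) 9 4"
  proof (rule balanced_generatedI)
    show "search_bipartitions ?vs (fold insert_facet ?bss Empty) (fold insert_facet ?bss Empty)"
      by (simp add: CP2_9_facets_def)
    show "\<Union>(set CP2_9_facets) = set ?vs"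
      by (rule set_eqI) (auto simp: CP2_9_facets_def)
    show "\<forall>A\<in>set ?As. A \<subseteq> set ?vs \<and> (\<forall>F\<in>set CP2_9_facets. \<not> A \<subseteq> F)"
      by (simp add: CP2_9_facets_def)
    show "\<forall>F\<in>set CP2_9_facets. card F = 9 - 4"
      by (simp add: CP2_9_facets_def)
    show "\<forall>v\<in>set ?vs. length (filter (\<lambda>A. v \<in> A) ?As) = 4"
      by simp
  qed (auto simp: CP2_9_facets_def)
  then show ?thesis by (simp add: CP2_9_def CP2_9_facets_def)
qed

section \<open>The quaternionic projective plane\<close>

text \<open>A vertex lies in the image of a set iff its preimage lies in the set, so the list holds
  the preimages under \<open>HP2_perm_P\<close>, lowered by one as indices start at 0.
  \<open>act_S\<close> does the same for \<open>HP2_perm_S\<close>.\<close>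

definition act_P :: "bool list \<Rightarrow> bool list" where
  "act_P bs = map ((!) bs) [4,0,1,2,3, 9,5,6,7,8, 14,10,11,12,13]"

definition act_S :: "bool list \<Rightarrow> bool list" where
  "act_S bs = map ((!) bs) [10,13,7,4,6,0,3,12,9,11,5,8,2,14,1]"

lemma act_P_simp [code]: "act_P [a1,a2,a3,a4,a5,a6,a7,a8,a9,a10,a11,a12,a13,a14,a15] =
  [a5,a1,a2,a3,a4,a10,a6,a7,a8,a9,a15,a11,a12,a13,a14]"
  by (simp add: act_P_def)

lemma act_S_simp [code]: "act_S [a1,a2,a3,a4,a5,a6,a7,a8,a9,a10,a11,a12,a13,a14,a15] =
  [a11,a14,a8,a5,a7,a1,a4,a13,a10,a12,a6,a9,a3,a15,a2]"
  by (simp add: act_S_def)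

definition char_vec :: "nat set \<Rightarrow> bool list" where
  "char_vec F = map (\<lambda>v. v \<in> F) [1,2,3,4,5,6,7,8,9,10,11,12,13,14,15]"

lemma HP2_perm_P_simps:
  "HP2_perm_P 1 = 2" "HP2_perm_P 2 = 3" "HP2_perm_P 3 = 4" "HP2_perm_P 4 = 5" "HP2_perm_P 5 = 1"
  "HP2_perm_P 6 = 7" "HP2_perm_P 7 = 8" "HP2_perm_P 8 = 9" "HP2_perm_P 9 = 10" "HP2_perm_P 10 = 6"
  "HP2_perm_P 11 = 12" "HP2_perm_P 12 = 13" "HP2_perm_P 13 = 14" "HP2_perm_P 14 = 15" "HP2_perm_P 15 = 11"
  by (simp_all add: HP2_perm_P_def transpose_def)

lemma HP2_perm_S_simps:
  "HP2_perm_S 1 = 6" "HP2_perm_S 6 = 11" "HP2_perm_S 11 = 1" "HP2_perm_S 2 = 15" "HP2_perm_S 15 = 14"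
  "HP2_perm_S 14 = 2" "HP2_perm_S 3 = 13" "HP2_perm_S 13 = 8" "HP2_perm_S 8 = 3" "HP2_perm_S 4 = 7"
  "HP2_perm_S 7 = 5" "HP2_perm_S 5 = 4" "HP2_perm_S 9 = 12" "HP2_perm_S 12 = 10" "HP2_perm_S 10 = 9"
  by (simp_all add: HP2_perm_S_def transpose_def)

lemma inj_HP2_perm_P: "inj HP2_perm_P" and inj_HP2_perm_S: "inj HP2_perm_S"
  unfolding HP2_perm_P_def HP2_perm_S_def
  by (intro inj_compose permutes_inj[OF cycle_permutes])+

lemma act_P_char_vec: "char_vec (HP2_perm_P ` F) = act_P (char_vec F)"
proof -
  have "(HP2_perm_P v \<in> HP2_perm_P ` F) = (v \<in> F)" for v
    by (rule inj_image_mem_iff[OF inj_HP2_perm_P])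
  \<comment> \<open>The images of the fifteen vertices are again all vertices, so these instances
    determine the whole vector.\<close>
  from this[of 1] this[of 2] this[of 3] this[of 4] this[of 5] this[of 6] this[of 7] this[of 8]
    this[of 9] this[of 10] this[of 11] this[of 12] this[of 13] this[of 14] this[of 15]
  show ?thesis unfolding HP2_perm_P_simps by (simp add: char_vec_def act_P_simp)
qed

lemma act_S_char_vec: "char_vec (HP2_perm_S ` F) = act_S (char_vec F)"
proof -
  have "(HP2_perm_S v \<in> HP2_perm_S ` F) = (v \<in> F)" for v
    by (rule inj_image_mem_iff[OF inj_HP2_perm_S])
  from this[of 1] this[of 2] this[of 3] this[of 4] this[of 5] this[of 6] this[of 7] this[of 8]
    this[of 9] this[of 10] this[of 11] this[of 12] this[of 13] this[of 14] this[of 15]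
  show ?thesis unfolding HP2_perm_S_simps by (simp add: char_vec_def act_S_simp)
qed

definition HP2_starts :: "nat list list" where
  "HP2_starts = [
    [1,2,3,6,8,11,13,14,15], [1,3,6,8,9,10,11,12,13],
    [1,2,6,9,10,11,12,14,15], [1,2,3,4,7,9,12,14,15],
    [1,2,4,7,9,10,12,13,14], [1,2,6,8,9,10,11,14,15],
    [1,2,3,4,5,6,9,11,13], [1,3,5,6,8,9,10,11,12],
    [1,3,5,6,7,8,9,10,11], [1,2,3,4,5,7,10,12,15],
    [1,2,3,7,8,10,12,13,14], [2,5,6,7,8,9,10,13,14],
    [3,4,6,7,11,12,13,14,15], [3,4,6,7,10,12,13,14,15]]"

lemma HP2_start_facets_eq: "HP2_start_facets = set ` set HP2_starts"
  unfolding HP2_start_facets_def HP2_starts_def list.set image_insert image_empty by (rule refl)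

text \<open>
  Read from left to right, these words represent the cosets of the subgroup of order five generated
  by \<^const>\<open>HP2_perm_P\<close> in the alternating group of order \<open>60\<close>.
\<close>

definition coset_words :: "bool list list" where
  "coset_words = (let P = False; S = True in
    [[], [S], [P,S], [P,P,S], [P,P,P,S], [S,P,P,S], [S,P,P,P,S], [S,S,P,P,S], [P,S,S,P,P,S],
     [P,P,S,S,P,P,S], [P,P,P,S,S,P,P,S], [S,P,P,P,S,S,P,P,S]])"

definition apply_word :: "bool list \<Rightarrow> bool list \<Rightarrow> bool list" where
  "apply_word = fold (\<lambda>s. if s then act_S else act_P)"

text \<open>Fourteen start facets, twelve words and five powers of \<open>HP2_perm_P\<close> give
  840 vectors, which run through the orbits of the start facets with repetitions.\<close>

definition HP2_vectors :: "bool list list" where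
  "HP2_vectors = concat (map (\<lambda>F. concat (map (\<lambda>w.
     let a = apply_word w (char_vec (set F)); b = act_P a; c = act_P b; d = act_P c
     in [a, b, c, d, act_P d]) coset_words)) HP2_starts)"

text \<open>\<open>act_P_char_vec\<close> and \<open>act_S_char_vec\<close> translate each letter of
  a word into a closure rule of \<open>HP2_facets\<close>.\<close>

lemma HP2_vectors_facets: "bs \<in> set HP2_vectors \<Longrightarrow> \<exists>F\<in>HP2_facets. bs = char_vec F"
proof -
  have word: "\<exists>G\<in>HP2_facets. apply_word w (char_vec F) = char_vec G" if "F \<in> HP2_facets" for w F
    using that
  proof (induction w arbitrary: F)
    case (Cons s w)
    then show ?case
      using HP2_facets.P[of F] HP2_facets.S[of F]
      by (cases s) (simp_all add: apply_word_def flip: act_P_char_vec act_S_char_vec)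
  qed (auto simp: apply_word_def)
  assume "bs \<in> set HP2_vectors"
  then obtain F w where F: "F \<in> set HP2_starts" and bs:
    "bs \<in> {apply_word w (char_vec (set F)), act_P (apply_word w (char_vec (set F))),
      act_P (act_P (apply_word w (char_vec (set F)))), act_P (act_P (act_P (apply_word w (char_vec (set F))))),
      act_P (act_P (act_P (act_P (apply_word w (char_vec (set F))))))}"
    by (auto simp: HP2_vectors_def Let_def)
  have "set F \<in> HP2_facets"
    using F by (intro HP2_facets.start) (simp add: HP2_start_facets_eq)
  from word[OF this] obtain G where "G \<in> HP2_facets" "apply_word w (char_vec (set F)) = char_vec G"
    by blast
  with bs show ?thesis
    by (auto simp flip: act_P_char_vec intro!: HP2_facets.P)
qed

lemma HP2_search_bipartitions:
  "let t = fold insert_facet HP2_vectors Empty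
   in search_bipartitions [1::nat,2,3,4,5,6,7,8,9,10,11,12,13,14,15] t t"
  by code_simp

lemma atLeastAtMost_15: "{1..15} = set [1::nat,2,3,4,5,6,7,8,9,10,11,12,13,14,15]"
  by (rule card_subset_eq[symmetric]) simp_all

lemma HP2_facets_subset_card: "F \<in> HP2_facets \<Longrightarrow> F \<subseteq> {1..15} \<and> card F = 9"
proof (induction rule: HP2_facets.induct)
  case (start F)
  then show ?case unfolding HP2_start_facets_def by (elim insertE emptyE; simp)
next
  case (P F)
  have "HP2_perm_P ` {1..15} \<subseteq> {1..15}"
    unfolding atLeastAtMost_15 list.set image_insert image_empty HP2_perm_P_simps by simp
  then show ?case using P by (auto simp: card_image inj_on_subset[OF inj_HP2_perm_P])
next
  case (S F)
  have "HP2_perm_S ` {1..15} \<subseteq> {1..15}"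
    unfolding atLeastAtMost_15 list.set image_insert image_empty HP2_perm_S_simps by simp
  then show ?case using S by (auto simp: card_image inj_on_subset[OF inj_HP2_perm_S])
qed

text \<open>The orbit of \<open>{1,2,4,9,11,12}\<close> under the group of order \<open>60\<close>.\<close>

definition HP2_nonfaces :: "nat set list" where
  "HP2_nonfaces = [
    {1,2,4,9,11,12}, {2,3,5,10,12,13}, {1,3,4,6,13,14}, {2,4,5,7,14,15}, {1,3,5,8,11,15},
    {1,6,7,10,12,15}, {2,6,7,8,11,13}, {3,7,8,9,12,14}, {4,8,9,10,13,15}, {5,6,9,10,11,14}]"

lemma HP2_perm_P_nonfaces: "A \<in> set HP2_nonfaces \<Longrightarrow> A \<in> (`) HP2_perm_P ` set HP2_nonfaces"
  unfolding HP2_nonfaces_def list.set image_insert image_empty HP2_perm_P_simps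
  by (elim insertE emptyE; simp add: insert_commute)

lemma HP2_perm_S_nonfaces: "A \<in> set HP2_nonfaces \<Longrightarrow> A \<in> (`) HP2_perm_S ` set HP2_nonfaces"
  unfolding HP2_nonfaces_def list.set image_insert image_empty HP2_perm_S_simps
  by (elim insertE emptyE; simp add: insert_commute)

text \<open>Each listed set is the image of a listed set under either generator, and both generators
  are injective, so an inclusion in a facet pulls back step by step to a start facet.\<close>

lemma HP2_nonfaces_not_subset:
  assumes "F \<in> HP2_facets" "A \<in> set HP2_nonfaces"
  shows "\<not> A \<subseteq> F"
  using assms
proof (induction F arbitrary: A rule: HP2_facets.induct)
  case (start F)
  have "\<forall>A\<in>set HP2_nonfaces. \<forall>F\<in>HP2_start_facets. \<not> A \<subseteq> F"
    by (simp add: HP2_nonfaces_def HP2_start_facets_def)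
  then show ?case using start by blast
next
  case (P F)
  then show ?case
    using HP2_perm_P_nonfaces[OF P.prems] inj_image_subset_iff[OF inj_HP2_perm_P] by blast
next
  case (S F)
  then show ?case
    using HP2_perm_S_nonfaces[OF S.prems] inj_image_subset_iff[OF inj_HP2_perm_S] by blast
qed

lemma balanced_HP2_15: "balanced HP2_15 15 6"
  unfolding HP2_15_def
proof (rule balanced_generatedI)
  let ?vs = "[1,2,3,4,5,6,7,8,9,10,11,12,13,14,15] :: nat list"
  show "search_bipartitions ?vs (fold insert_facet HP2_vectors Empty) (fold insert_facet HP2_vectors Empty)"
    using HP2_search_bipartitions by (simp only: Let_def)
  show "\<exists>F\<in>HP2_facets. bs = map (\<lambda>v. v \<in> F) ?vs" if "bs \<in> set HP2_vectors" for bs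
    using HP2_vectors_facets[OF that] by (simp only: char_vec_def)
  \<comment> \<open>Three start facets already cover all fifteen vertices.\<close>
  have "{1,2,3,6,8,11,13,14,15} \<in> HP2_facets" "{1,2,4,7,9,10,12,13,14} \<in> HP2_facets"
      "{1,2,3,4,5,6,9,11,13} \<in> HP2_facets"
    by (rule HP2_facets.start, simp add: HP2_start_facets_def)+
  then have sup: "{1,2,3,6,8,11,13,14,15} \<union> {1,2,4,7,9,10,12,13,14} \<union> {1,2,3,4,5,6,9,11,13} \<subseteq> \<Union>HP2_facets"
    by blast
  have "set ?vs \<subseteq>
      {1,2,3,6,8,11,13,14,15} \<union> {1,2,4,7,9,10,12,13,14} \<union> {1,2,3,4,5,6,9,11,13}"
    by simp
  also note sup
  finally have "set ?vs \<subseteq> \<Union>HP2_facets" .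
  moreover have "\<Union>HP2_facets \<subseteq> set ?vs"
    using HP2_facets_subset_card unfolding atLeastAtMost_15 by blast
  ultimately show "\<Union>HP2_facets = set ?vs" by (rule subset_antisym[rotated])
  show "HP2_facets \<noteq> {}" using HP2_facets.start by (auto simp: HP2_start_facets_def)
  show "\<forall>F\<in>HP2_facets. card F = 15 - 6" using HP2_facets_subset_card by auto
  show "\<forall>A\<in>set HP2_nonfaces. A \<subseteq> set ?vs \<and> (\<forall>F\<in>HP2_facets. \<not> A \<subseteq> F)"
    using HP2_nonfaces_not_subset by (auto simp: HP2_nonfaces_def)
  show "\<forall>v\<in>set ?vs. length (filter (\<lambda>A. v \<in> A) HP2_nonfaces) = 4"
    by (simp add: HP2_nonfaces_def)
qed (simp_all add: HP2_nonfaces_def)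

section \<open>Edge sets of the complete graph on six vertices\<close>

lemma K6_edges_iff: "e \<in> K6_edges \<longleftrightarrow> (\<exists>a\<in>{1..6}. \<exists>b\<in>{1..6}. a \<noteq> b \<and> e = {a, b})"
  unfolding K6_edges_def by (auto simp: card_2_iff)

lemma card_K6_edges: "card K6_edges = 15"
  unfolding K6_edges_def by (subst n_subsets) (simp_all add: choose_two)

text \<open>The Ramsey bound R(3,3) \<le> 6. Three of the five edges at vertex \<open>1\<close>
  share a colour; either an edge between their ends has it too, or these ends form a triangle of the
  other colour.\<close>

lemma triangle_2_colouring:
  fixes E :: "nat \<Rightarrow> nat \<Rightarrow> bool"
  assumes sym: "\<And>a b. E a b = E b a"
  obtains a b c where "a \<in> {1..6}" "b \<in> {1..6}" "c \<in> {1..6}" "a \<noteq> b" "a \<noteq> c" "b \<noteq> c"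
    "E a b = E a c" "E a b = E b c"
proof -
  let ?N = "\<lambda>p. {b \<in> {2..6}. E 1 b = p}"
  have "card {2..6::nat} = card (?N True \<union> ?N False)" by (rule arg_cong[of _ _ card]) auto
  also have "\<dots> = card (?N True) + card (?N False)" by (rule card_Un_disjoint) auto
  finally have "3 \<le> card (?N True) \<or> 3 \<le> card (?N False)" by (simp, linarith)
  then obtain p where "3 \<le> card (?N p)" by blast
  then obtain T where "T \<subseteq> ?N p" "card T = 3" by (meson obtain_subset_with_card_n)
  then obtain a b c where abc: "a \<noteq> b" "a \<noteq> c" "b \<noteq> c" "{a, b, c} \<subseteq> ?N p"
    by (auto simp: card_3_iff)
  have N: "x \<in> {1..6}" "x \<noteq> 1" "E 1 x = p" "E x 1 = p" if "x \<in> {a, b, c}" for x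
    using abc(4) that sym[of x 1] by auto
  consider "E a b = p" | "E a c = p" | "E b c = p" | "E a b = (\<not> p)" "E a c = (\<not> p)" "E b c = (\<not> p)"
    by blast
  then show thesis
  proof cases
    case 1
    show thesis by (rule that[of 1 a b]) (use 1 N[of a] N[of b] abc(1) in simp_all)
  next
    case 2
    show thesis by (rule that[of 1 a c]) (use 2 N[of a] N[of c] abc(2) in simp_all)
  next
    case 3
    show thesis by (rule that[of 1 b c]) (use 3 N[of b] N[of c] abc(3) in simp_all)
  next
    case 4
    show thesis by (rule that[of a b c]) (use 4 N[of a] N[of b] N[of c] abc(1-3) in simp_all)
  qed
qed

text \<open>Membership in \<open>A\<close> colours the edges. The edges of a monochromatic triangle
  all lie outside \<open>A\<close>, so that \<open>A\<close> is a face, or all in \<open>A\<close>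
  and thus outside \<open>B\<close>, so that \<open>B\<close> is a face.\<close>

lemma two_block_R3: "two_block R3"
proof -
  have "A \<in> snd R3 \<or> B \<in> snd R3" if AB: "A \<subseteq> K6_edges" "B \<subseteq> K6_edges" "A \<inter> B = {}" for A B
  proof -
    have "{a, b} \<in> A \<longleftrightarrow> {b, a} \<in> A" for a b by (simp add: insert_commute)
    then obtain a b c where abc: "a \<in> {1..6}" "b \<in> {1..6}" "c \<in> {1..6}" "a \<noteq> b" "a \<noteq> c" "b \<noteq> c"
      and mono: "({a, b} \<in> A) = ({a, c} \<in> A)" "({a, b} \<in> A) = ({b, c} \<in> A)"
      by (rule triangle_2_colouring)
    have "{{a, b}, {a, c}, {b, c}} \<subseteq> K6_edges" using abc by (auto simp: K6_edges_def)
    moreover have "\<Gamma> \<in> snd R3" if "\<Gamma> \<subseteq> K6_edges" "{{a, b}, {a, c}, {b, c}} \<subseteq> K6_edges - \<Gamma>" for \<Gamma>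
      using that abc unfolding R3_def snd_conv mem_Collect_eq by blast
    moreover have "{{a, b}, {a, c}, {b, c}} \<subseteq> K6_edges - A \<or> {{a, b}, {a, c}, {b, c}} \<subseteq> K6_edges - B"
      using mono AB(3) calculation(1) by blast
    ultimately show ?thesis using AB by blast
  qed
  moreover have "fst R3 \<notin> snd R3" by (simp add: R3_def)
  ultimately show ?thesis by (simp add: two_block_def is_complex_R3) (simp add: R3_def)
qed

text \<open>
  A union of two disjoint triangles is a nonface, as its complement is bipartite. The ten
  possibilities are listed by the vertex set of the triangle that contains the vertex \<open>1\<close>.
\<close>

definition K6_halves :: "nat set list" where
  "K6_halves = [{1,2,3}, {1,2,4}, {1,2,5}, {1,2,6}, {1,3,4}, {1,3,5}, {1,3,6}, {1,4,5}, {1,4,6}, {1,5,6}]"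

text \<open>A half that contains a given edge is fixed by its third vertex, for which there are four
  choices.\<close>

lemma nonface_cover_R3:
  "nonface_cover R3 (map (\<lambda>T. {e \<in> K6_edges. e \<subseteq> T \<or> e \<inter> T = {}}) K6_halves) 4"
proof -
  have "{e \<in> K6_edges. e \<subseteq> T \<or> e \<inter> T = {}} \<notin> snd R3" for T
  proof
    assume "{e \<in> K6_edges. e \<subseteq> T \<or> e \<inter> T = {}} \<in> snd R3"
    then obtain a b c where "{{a, b}, {a, c}, {b, c}} \<subseteq> K6_edges - {e \<in> K6_edges. e \<subseteq> T \<or> e \<inter> T = {}}"
      by (auto simp: R3_def)
    \<comment> \<open>Each edge of the triangle would have exactly one end in \<open>T\<close>, but
      two of its three vertices are on the same side.\<close>
    then show False by auto
  qed
  moreover have "length (filter (\<lambda>T. e \<subseteq> T \<or> e \<inter> T = {}) K6_halves) = 4" if e: "e \<in> K6_edges" for e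
  proof -
    have I: "{1..6::nat} = {1,2,3,4,5,6}" by auto
    obtain a b where ab: "a \<in> {1..6}" "b \<in> {1..6}" "a \<noteq> b" "e = {a, b}"
      using e unfolding K6_edges_iff by blast
    from ab[unfolded I] show ?thesis by (elim insertE emptyE; simp add: K6_halves_def)
  qed
  ultimately show ?thesis
    by (auto simp: nonface_cover_def R3_def filter_map o_def)
qed

theorem theorem6p2:
  shows "(\<forall>n::nat. n \<ge> 1 \<longrightarrow>
      (partition_number (join_power P3_hat n) = n + 1 \<and>
        partition_number (join_power three_points n) = n + 1 \<and>
        partition_number (join_power RP2_6 n) = n + 1 \<and>
        partition_number (join_power CP2_9 n) = n + 1 \<and>
        partition_number (join_power HP2_15 n) = n + 1 \<and>
        partition_number (join_power R3 n) = n + 1) \<and>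
      (threshold_char (join_power P3_hat n) = ennreal (3 / (7 * real n)) \<and>
        threshold_char (join_power three_points n) = ennreal (2 / (3 * real n)) \<and>
        threshold_char (join_power RP2_6 n) = ennreal (1 / (2 * real n)) \<and>
        threshold_char (join_power CP2_9 n) = ennreal (4 / (9 * real n)) \<and>
        threshold_char (join_power HP2_15 n) = ennreal (6 / (15 * real n)) \<and>
        threshold_char (join_power R3 n) \<le> ennreal (6 / (15 * real n))) \<and>
      (nonlinearity_gap (join_power P3_hat n) = \<lfloor>4 * real n / 3\<rfloor> \<and>
        nonlinearity_gap (join_power three_points n) = \<lfloor>real n / 2\<rfloor> \<and>
        nonlinearity_gap (join_power RP2_6 n) = int n \<and>
        nonlinearity_gap (join_power CP2_9 n) = \<lfloor>5 * real n / 4\<rfloor> \<and>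
        nonlinearity_gap (join_power HP2_15 n) = \<lfloor>3 * real n / 2\<rfloor>) \<and>
      (num_vertices (join_power P3_hat n) = 7 * n \<and>
        num_vertices (join_power three_points n) = 3 * n \<and>
        num_vertices (join_power RP2_6 n) = 6 * n \<and>
        num_vertices (join_power CP2_9 n) = 9 * n \<and>
        num_vertices (join_power HP2_15 n) = 15 * n \<and>
        num_vertices (join_power R3 n) = 15 * n) \<and>
      (real_of_int (nonlinearity_gap (join_power RP2_6 n)) / real (num_vertices (join_power RP2_6 n)) = 1 / 6)) \<and>
    ((\<lambda>n. real_of_int (nonlinearity_gap (join_power P3_hat n)) / real (num_vertices (join_power P3_hat n)))
      \<longlonglongrightarrow> 4 / 21) \<and>
    ((\<lambda>n. real_of_int (nonlinearity_gap (join_power three_points n)) / real (num_vertices (join_power three_points n)))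
      \<longlonglongrightarrow> 1 / 6) \<and>
    ((\<lambda>n. real_of_int (nonlinearity_gap (join_power CP2_9 n)) / real (num_vertices (join_power CP2_9 n)))
      \<longlonglongrightarrow> 5 / 36) \<and>
    ((\<lambda>n. real_of_int (nonlinearity_gap (join_power HP2_15 n)) / real (num_vertices (join_power HP2_15 n)))
      \<longlonglongrightarrow> 1 / 10)"
proof -
  note complexes = balanced_P3_hat balanced_three_points balanced_RP2_6 balanced_CP2_9 balanced_HP2_15
  note pi = partition_number_join_power[OF two_block_R3]
    complexes[THEN balanced_two_block, THEN partition_number_join_power]
  note rho = complexes[THEN threshold_char_join_power]
  note gap = complexes[THEN nonlinearity_gap_join_power]
  have card_R3: "card (fst R3) = 15" by (simp add: R3_def card_K6_edges)
  note vertices = num_vertices_join_power[OF card_R3]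
    complexes[THEN balanced_card, THEN num_vertices_join_power]
  \<comment> \<open>\<open>2 / 5\<close> is the reduced form both of \<open>4 / 10\<close>, given by
    the cover, and of \<open>6 / 15\<close> in the claim.\<close>
  have rho_R3: "threshold_char (join_power R3 n) \<le> ennreal (2 / (5 * real n))" if "n \<ge> 1" for n
    using threshold_char_join_power_le[OF two_block_finite[OF two_block_R3] nonface_cover_R3 _ that]
    by (simp add: K6_halves_def)
  show ?thesis
    using gap_ratio_join_power_tendsto[OF balanced_P3_hat] gap_ratio_join_power_tendsto[OF balanced_three_points]
      gap_ratio_join_power_tendsto[OF balanced_CP2_9] gap_ratio_join_power_tendsto[OF balanced_HP2_15]
    by (simp add: pi rho gap vertices rho_R3)
qed

end
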